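(* Let $K$ be a compact Hausdorff space, let $\varepsilon\ge 0$, and let $T\in B(C(K))$ be $\varepsilon$-band preserving, where $C(K)$ carries the supremum norm. Then there exists a band preserving operator $S\in B(C(K))$ such that $\|T-S\|\le 2\varepsilon$. If $T$ is positive, then $S$ can be selected to be positive as well.
   Context: $B(X)$ denotes the space of bounded linear operators on $X$. A band in a Banach lattice $X$ is an (order) ideal $Y\subset X$ which contains $\bigvee_\alpha y_\alpha$ for every family $(y_\alpha)$ in $Y$ whose supremum exists in $X$. A linear operator $T:X\to X$ is band preserving (BP) if $T(Y)\subset Y$ for every band $Y\subset X$. A linear map $T:X\to X$ is $\varepsilon$-band preserving ($\varepsilon$-BP) if for every $x\in X$, $\sup\{\||Tx|\wedge y\| : y\ge 0,\ y\perp x\}\le\varepsilon\|x\|$. $C(K)$ is ordered pointwise. *)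

theory Defs
  imports "HOL-Analysis.Analysis" "HOL-Library.Lattice_Algebras" "HOL-Library.Lub_Glb"
begin

section \<open>Normed vector lattices\<close>

text \<open>
  Completeness is not part of this class: a Banach lattice is a complete member of it. None of
  the order-theoretic notions below refers to completeness.
\<close>

class normed_vector_lattice =
  real_normed_vector + ordered_real_vector + lattice_ab_group_add_abs +
  assumes norm_mono_abs: "\<bar>x\<bar> \<le> \<bar>y\<bar> \<Longrightarrow> norm x \<le> norm y"

instance real :: normed_vector_lattice
  by standard simp

lemma norm_abs_eq [simp]: "norm \<bar>x\<bar> = norm (x :: 'a :: normed_vector_lattice)"
  by (rule order.antisym; rule norm_mono_abs) (simp_all add: abs_of_nonneg)

lemma norm_abs_diff_le:
  fixes x y :: "'a :: normed_vector_lattice"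
  shows "norm (\<bar>x\<bar> - \<bar>y\<bar>) \<le> norm (x - y)"
  by (rule norm_mono_abs) (rule abs_triangle_ineq3)

lemma continuous_on_abs_lattice:
  fixes f :: "'a :: topological_space \<Rightarrow> 'b :: normed_vector_lattice"
  assumes "continuous_on A f"
  shows "continuous_on A (\<lambda>x. \<bar>f x\<bar>)"
proof -
  have "continuous_on UNIV (abs :: 'b \<Rightarrow> 'b)"
    unfolding continuous_on_iff dist_norm
    by (meson norm_abs_diff_le le_less_trans)
  from continuous_on_compose2[OF this assms] show ?thesis by simp
qed

lemma sup_eq_half:
  fixes x y :: "'a :: normed_vector_lattice"
  shows "sup x y = (1/2) *\<^sub>R (x + y + \<bar>x - y\<bar>)"
proof -
  have "x + y + \<bar>x - y\<bar> = sup (x + y + (x - y)) (x + y + (- (x - y)))"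
    by (simp only: abs_lattice add_sup_distrib_left)
  also have "\<dots> = sup (x + x) (y + y)"
    by (simp add: algebra_simps)
  also have "\<dots> = sup x y + sup x y"
  proof (rule order.antisym)
    show "sup (x + x) (y + y) \<le> sup x y + sup x y"
      by (intro sup_least add_mono) simp_all
    have "x + y \<le> sup (x + x) (y + y)"
    proof -
      have "(x + y) + (x + y) = (x + x) + (y + y)"
        by (simp add: algebra_simps)
      also have "\<dots> \<le> sup (x + x) (y + y) + sup (x + x) (y + y)"
        by (intro add_mono) simp_all
      finally have "0 \<le> (sup (x + x) (y + y) - (x + y)) + (sup (x + x) (y + y) - (x + y))"
        by (simp only: algebra_simps add_0)
      then show ?thesis
        by (simp only: zero_le_double_add_iff_zero_le_single_add diff_ge_0_iff_ge)
    qed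
    then show "sup x y + sup x y \<le> sup (x + x) (y + y)"
      by (simp add: add_sup_distrib_left add_sup_distrib_right add.commute)
  qed
  finally show ?thesis
    by (simp add: scaleR_2[symmetric])
qed

lemma inf_eq_neg_sup_neg:
  fixes x y :: "'a :: normed_vector_lattice"
  shows "inf x y = - sup (- x) (- y)"
  by simp

section \<open>Bounded continuous functions with the pointwise order\<close>

unbundle bcontfun.lifting

instantiation bcontfun :: (topological_space, normed_vector_lattice) normed_vector_lattice
begin

lift_definition less_eq_bcontfun :: "('a \<Rightarrow>\<^sub>C 'b) \<Rightarrow> ('a \<Rightarrow>\<^sub>C 'b) \<Rightarrow> bool"
  is "\<lambda>f g. \<forall>x. f x \<le> g x" .

definition less_bcontfun :: "('a \<Rightarrow>\<^sub>C 'b) \<Rightarrow> ('a \<Rightarrow>\<^sub>C 'b) \<Rightarrow> bool"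
  where "less_bcontfun f g \<longleftrightarrow> f \<le> g \<and> \<not> g \<le> f"

lemma abs_cont: "f \<in> bcontfun \<Longrightarrow> (\<lambda>x. \<bar>f x\<bar>) \<in> bcontfun" for f :: "'a \<Rightarrow> 'b"
  by (auto simp: bcontfun_def bounded_iff intro!: continuous_on_abs_lattice)

lemma sup_cont: "f \<in> bcontfun \<Longrightarrow> g \<in> bcontfun \<Longrightarrow> (\<lambda>x. sup (f x) (g x)) \<in> bcontfun"
  for f g :: "'a \<Rightarrow> 'b"
  unfolding sup_eq_half by (intro scaleR_cont plus_cont abs_cont minus_cont)

lemma inf_cont: "f \<in> bcontfun \<Longrightarrow> g \<in> bcontfun \<Longrightarrow> (\<lambda>x. inf (f x) (g x)) \<in> bcontfun"
  for f g :: "'a \<Rightarrow> 'b"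
  unfolding inf_eq_neg_sup_neg by (intro uminus_cont sup_cont)

lift_definition abs_bcontfun :: "('a \<Rightarrow>\<^sub>C 'b) \<Rightarrow> 'a \<Rightarrow>\<^sub>C 'b" is "\<lambda>f x. \<bar>f x\<bar>"
  by (rule abs_cont)

lift_definition sup_bcontfun :: "('a \<Rightarrow>\<^sub>C 'b) \<Rightarrow> ('a \<Rightarrow>\<^sub>C 'b) \<Rightarrow> 'a \<Rightarrow>\<^sub>C 'b"
  is "\<lambda>f g x. sup (f x) (g x)"
  by (rule sup_cont)

lift_definition inf_bcontfun :: "('a \<Rightarrow>\<^sub>C 'b) \<Rightarrow> ('a \<Rightarrow>\<^sub>C 'b) \<Rightarrow> 'a \<Rightarrow>\<^sub>C 'b"
  is "\<lambda>f g x. inf (f x) (g x)"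
  by (rule inf_cont)

instance
proof
  fix f g h :: "'a \<Rightarrow>\<^sub>C 'b" and a b :: real
  show "(f < g) = (f \<le> g \<and> \<not> g \<le> f)" by (rule less_bcontfun_def)
  show "f \<le> f" by transfer simp
  show "f \<le> g \<Longrightarrow> g \<le> h \<Longrightarrow> f \<le> h" by transfer (blast intro: order_trans)
  show "f \<le> g \<Longrightarrow> g \<le> f \<Longrightarrow> f = g" by transfer (auto intro: order.antisym)
  show "f \<le> g \<Longrightarrow> h + f \<le> h + g" by transfer simp
  show "f \<le> g \<Longrightarrow> 0 \<le> a \<Longrightarrow> a *\<^sub>R f \<le> a *\<^sub>R g" by transfer (simp add: scaleR_left_mono)
  show "a \<le> b \<Longrightarrow> 0 \<le> f \<Longrightarrow> a *\<^sub>R f \<le> b *\<^sub>R f" by transfer (simp add: scaleR_right_mono)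
  show "inf f g \<le> f" by transfer simp
  show "inf f g \<le> g" by transfer simp
  show "f \<le> g \<Longrightarrow> f \<le> h \<Longrightarrow> f \<le> inf g h" by transfer simp
  show "f \<le> sup f g" by transfer simp
  show "g \<le> sup f g" by transfer simp
  show "g \<le> f \<Longrightarrow> h \<le> f \<Longrightarrow> sup g h \<le> f" by transfer simp
  show "\<bar>f\<bar> = sup f (- f)" by transfer (simp add: abs_lattice)
  show "norm f \<le> norm g" if "\<bar>f\<bar> \<le> \<bar>g\<bar>"
  proof (rule norm_bound)
    fix x
    have "norm (f x) \<le> norm (g x)"
      using that by transfer (simp add: norm_mono_abs)
    also have "\<dots> \<le> norm g" by (rule norm_bounded)
    finally show "norm (f x) \<le> norm g" .
  qed
qed

end

section \<open>Bands and band preserving operators\<close>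

definition order_ideal :: "'a :: normed_vector_lattice set \<Rightarrow> bool" where
  "order_ideal Y \<longleftrightarrow> subspace Y \<and> (\<forall>x y. y \<in> Y \<and> \<bar>x\<bar> \<le> \<bar>y\<bar> \<longrightarrow> x \<in> Y)"

definition band :: "'a :: normed_vector_lattice set \<Rightarrow> bool" where
  "band Y \<longleftrightarrow> order_ideal Y \<and> (\<forall>A s. A \<subseteq> Y \<and> isLub UNIV A s \<longrightarrow> s \<in> Y)"

definition lattice_disjoint :: "'a :: normed_vector_lattice \<Rightarrow> 'a \<Rightarrow> bool" where
  "lattice_disjoint x y \<longleftrightarrow> inf \<bar>x\<bar> \<bar>y\<bar> = 0"

definition band_preserving :: "('a :: normed_vector_lattice \<Rightarrow> 'a) \<Rightarrow> bool" where
  "band_preserving T \<longleftrightarrow> linear T \<and> (\<forall>Y. band Y \<longrightarrow> T ` Y \<subseteq> Y)"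

text \<open>
  The supremum is over a nonempty set (it contains the value at \<open>y = 0\<close>) that is bounded above
  by \<open>norm (T x)\<close>, so the supremum operator of the reals is the true one here.
\<close>

definition eps_band_preserving :: "real \<Rightarrow> ('a :: normed_vector_lattice \<Rightarrow> 'a) \<Rightarrow> bool" where
  "eps_band_preserving \<epsilon> T \<longleftrightarrow> linear T \<and>
     (\<forall>x. (SUP y\<in>{y. 0 \<le> y \<and> lattice_disjoint y x}. norm (inf \<bar>T x\<bar> y)) \<le> \<epsilon> * norm x)"

definition positive_operator :: "('a :: normed_vector_lattice \<Rightarrow> 'a) \<Rightarrow> bool" where
  "positive_operator T \<longleftrightarrow> (\<forall>x\<ge>0. 0 \<le> T x)"

lemma eps_band_preserving_set_bounded:
  fixes T :: "'a :: normed_vector_lattice \<Rightarrow> 'a"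
  shows "bdd_above ((\<lambda>y. norm (inf \<bar>T x\<bar> y)) ` {y. 0 \<le> y \<and> lattice_disjoint y x})"
    and "0 \<in> {y. 0 \<le> y \<and> lattice_disjoint y x}"
proof -
  show "bdd_above ((\<lambda>y. norm (inf \<bar>T x\<bar> y)) ` {y. 0 \<le> y \<and> lattice_disjoint y x})"
    by (rule bdd_aboveI2[where M = "norm (T x)"]) (auto intro!: norm_mono_abs simp: abs_of_nonneg)
  show "0 \<in> {y. 0 \<le> y \<and> lattice_disjoint y x}"
    by (simp add: lattice_disjoint_def inf_absorb1)
qed

end

theory Submission
  imports Defs
begin

text \<open>
  If \<open>f t = 0\<close>, truncating \<open>f\<close> at height \<open>\<delta>\<close> changes it by at most \<open>\<delta>\<close> and leaves a function
  disjoint from a multiple of \<open>(\<delta> - |f|)\<^sup>+\<close> that is as large at \<open>t\<close> as desired; hence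
  \<open>|T f t| \<le> \<epsilon> * norm f\<close>. Applied to \<open>f - f t\<close>, which vanishes at \<open>t\<close> and has norm at most
  \<open>2 * norm f\<close>, this says that multiplication by \<open>T 1\<close> is within \<open>2 * \<epsilon>\<close> of \<open>T\<close>.
\<close>

definition truncation :: "'a :: lattice_ab_group_add_abs \<Rightarrow> 'a \<Rightarrow> 'a"
  where "truncation e x = sup (inf x e) (- e)"

lemma abs_truncation_le:
  assumes "0 \<le> e"
  shows "\<bar>truncation e x\<bar> \<le> e"
proof (rule abs_leI)
  have "- e \<le> e"
    using assms by (simp add: minus_le_self_iff)
  then show "truncation e x \<le> e"
    by (simp add: truncation_def)
  show "- truncation e x \<le> e"
    by (subst minus_le_iff) (simp add: truncation_def)
qed

lemma diff_truncation_eq: "x - truncation e x = inf (pprt (x - e)) (x + e)"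
proof -
  have "x - truncation e x = x + inf (sup (- x) (- e)) e"
    unfolding diff_conv_add_uminus truncation_def neg_sup_eq_inf neg_inf_eq_sup minus_minus ..
  also have "\<dots> = inf (sup (x + - x) (x + - e)) (x + e)"
    by (simp only: add_inf_distrib_left add_sup_distrib_left)
  also have "\<dots> = inf (pprt (x - e)) (x + e)"
    by (simp add: pprt_def sup_commute)
  finally show ?thesis .
qed

lemma abs_diff_truncation_le: "\<bar>x - truncation e x\<bar> \<le> pprt (\<bar>x\<bar> - e)"
proof (rule abs_leI)
  have "x - truncation e x \<le> pprt (x - e)"
    by (simp add: diff_truncation_eq)
  also have "\<dots> \<le> pprt (\<bar>x\<bar> - e)"
    by (intro pprt_mono diff_right_mono abs_ge_self)
  finally show "x - truncation e x \<le> pprt (\<bar>x\<bar> - e)" .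
next
  have "- (x + e) \<le> \<bar>x\<bar> - e"
    using abs_ge_minus_self[of x] by (simp add: algebra_simps)
  then have "- (x - truncation e x) \<le> sup 0 (\<bar>x\<bar> - e)"
    unfolding diff_truncation_eq neg_inf_eq_sup
    by (intro sup_mono) simp_all
  then show "- (x - truncation e x) \<le> pprt (\<bar>x\<bar> - e)"
    by (simp add: pprt_def sup_commute)
qed

lemma norm_truncation_le:
  fixes x :: "'a :: normed_vector_lattice"
  assumes "0 \<le> e"
  shows "norm (truncation e x) \<le> norm e"
  using norm_mono_abs[of "truncation e x" e] abs_truncation_le[OF assms, of x] assms
  by (simp add: abs_of_nonneg)

lemma norm_diff_truncation_le:
  fixes x :: "'a :: normed_vector_lattice"
  assumes "0 \<le> e"
  shows "norm (x - truncation e x) \<le> norm x"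
proof (rule norm_mono_abs)
  have "\<bar>x - truncation e x\<bar> \<le> pprt (\<bar>x\<bar> - e)"
    by (rule abs_diff_truncation_le)
  also have "\<dots> \<le> \<bar>x\<bar>"
    using assms by (simp add: pprt_def)
  finally show "\<bar>x - truncation e x\<bar> \<le> \<bar>x\<bar>" .
qed

lemma inf_pprt_pprt_minus: "inf (pprt x) (pprt (- x)) = 0"
  for x :: "'a :: lattice_ab_group_add"
proof -
  have "pprt x = - nprt x + x"
    by (simp add: eq_diff_eq flip: prts)
  then have "inf (pprt x) (- nprt x) = inf (- nprt x + x) (- nprt x + 0)"
    by simp
  also have "\<dots> = - nprt x + nprt x"
    unfolding nprt_def by (rule add_inf_distrib_left[symmetric])
  finally show ?thesis
    by (simp add: pprt_neg)
qed

lemma lattice_disjoint_diff_truncation: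
  "lattice_disjoint (pprt (e - \<bar>x\<bar>)) (x - truncation e x)"
proof -
  have "inf (pprt (e - \<bar>x\<bar>)) \<bar>x - truncation e x\<bar> \<le> inf (pprt (e - \<bar>x\<bar>)) (pprt (\<bar>x\<bar> - e))"
    by (intro inf_mono order_refl abs_diff_truncation_le)
  also have "\<dots> = 0"
    using inf_pprt_pprt_minus[of "e - \<bar>x\<bar>"] by simp
  finally show ?thesis
    unfolding lattice_disjoint_def by (intro order.antisym) (simp_all add: abs_of_nonneg)
qed

lemma band_preserving_if_abs_le:
  fixes T :: "'a :: normed_vector_lattice \<Rightarrow> 'a"
  assumes "linear T" and T: "\<And>x. \<bar>T x\<bar> \<le> c *\<^sub>R \<bar>x\<bar>"
  shows "band_preserving T"
  unfolding band_preserving_def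
proof (intro conjI allI impI image_subsetI)
  fix Y :: "'a set" and x assume "band Y" and "x \<in> Y"
  then have ideal: "order_ideal Y"
    by (simp add: band_def)
  then have "\<bar>x\<bar> \<in> Y"
    using \<open>x \<in> Y\<close> unfolding order_ideal_def by (metis abs_idempotent order_refl)
  then have "c *\<^sub>R \<bar>x\<bar> \<in> Y"
    using ideal by (simp add: order_ideal_def subspace_scale)
  moreover have "\<bar>T x\<bar> \<le> \<bar>c *\<^sub>R \<bar>x\<bar>\<bar>"
    using T abs_ge_self by (rule order_trans)
  ultimately show "T x \<in> Y"
    using ideal by (auto simp: order_ideal_def)
qed (fact assms)

lemma eps_band_preservingD:
  assumes "eps_band_preserving \<epsilon> T" and "0 \<le> y" and "lattice_disjoint y x"
  shows "norm (inf \<bar>T x\<bar> y) \<le> \<epsilon> * norm x"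
proof -
  have "norm (inf \<bar>T x\<bar> y) \<le> (SUP y\<in>{y. 0 \<le> y \<and> lattice_disjoint y x}. norm (inf \<bar>T x\<bar> y))"
    by (rule cSUP_upper) (use assms eps_band_preserving_set_bounded in auto)
  also have "\<dots> \<le> \<epsilon> * norm x"
    using assms(1) by (simp add: eps_band_preserving_def)
  finally show ?thesis .
qed

lemma apply_bcontfun_lattice_simps [simp]:
  fixes f g :: "'a :: topological_space \<Rightarrow>\<^sub>C 'b :: normed_vector_lattice"
  shows "apply_bcontfun (sup f g) x = sup (f x) (g x)"
    and "apply_bcontfun (inf f g) x = inf (f x) (g x)"
    and "apply_bcontfun \<bar>f\<bar> x = \<bar>f x\<bar>"
    and "apply_bcontfun (pprt f) x = pprt (f x)"
  unfolding pprt_def by (transfer; simp)+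

lemma lattice_disjoint_bcontfun_iff:
  fixes f g :: "'a :: topological_space \<Rightarrow>\<^sub>C real"
  shows "lattice_disjoint f g \<longleftrightarrow> (\<forall>x. f x = 0 \<or> g x = 0)"
proof -
  have "inf \<bar>a\<bar> \<bar>b\<bar> = 0 \<longleftrightarrow> a = 0 \<or> b = 0" for a b :: real
    by (auto simp: inf_min min_def)
  then show ?thesis
    unfolding lattice_disjoint_def by (simp flip: apply_bcontfun_inject add: fun_eq_iff)
qed

instantiation bcontfun :: (topological_space, real_normed_algebra_1) real_normed_algebra_1
begin

lift_definition one_bcontfun :: "'a \<Rightarrow>\<^sub>C 'b" is "\<lambda>_. 1"
  by (rule const_bcontfun)

lift_definition times_bcontfun :: "('a \<Rightarrow>\<^sub>C 'b) \<Rightarrow> ('a \<Rightarrow>\<^sub>C 'b) \<Rightarrow> 'a \<Rightarrow>\<^sub>C 'b"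
  is "\<lambda>f g x. f x * g x"
proof -
  fix f g :: "'a \<Rightarrow> 'b" assume "f \<in> bcontfun" and "g \<in> bcontfun"
  then obtain F G :: "'a \<Rightarrow>\<^sub>C 'b" where "f = F" and "g = G"
    by (elim bcontfunE)
  moreover have "norm (F x * G x) \<le> norm F * norm G" for x
    by (intro order_trans[OF norm_mult_ineq] mult_mono norm_bounded norm_ge_zero)
  ultimately show "(\<lambda>x. f x * g x) \<in> bcontfun"
    by (auto intro!: bcontfun_normI continuous_intros)
qed

instance
proof
  fix f g h :: "'a \<Rightarrow>\<^sub>C 'b" and a :: real
  show "f * g * h = f * (g * h)" by transfer (simp add: mult.assoc)
  show "(f + g) * h = f * h + g * h" by transfer (simp add: distrib_right)
  show "f * (g + h) = f * g + f * h" by transfer (simp add: distrib_left)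
  show "a *\<^sub>R f * g = a *\<^sub>R (f * g)" by transfer simp
  show "f * a *\<^sub>R g = a *\<^sub>R (f * g)" by transfer simp
  show "1 * f = f" by transfer simp
  show "f * 1 = f" by transfer simp
  show "(0 :: 'a \<Rightarrow>\<^sub>C 'b) \<noteq> 1" by transfer (simp add: fun_eq_iff)
  show "norm (f * g) \<le> norm f * norm g"
  proof (rule norm_bound)
    show "norm ((f * g) x) \<le> norm f * norm g" for x
      unfolding times_bcontfun.rep_eq
      by (intro order_trans[OF norm_mult_ineq] mult_mono norm_bounded norm_ge_zero)
  qed
  show "norm (1 :: 'a \<Rightarrow>\<^sub>C 'b) = 1"
    unfolding norm_bcontfun_def dist_bcontfun_def by transfer simp
qed

end

declare one_bcontfun.rep_eq [simp] times_bcontfun.rep_eq [simp]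

lemma band_preserving_bcontfun_mult:
  fixes \<phi> :: "'a :: topological_space \<Rightarrow>\<^sub>C real"
  shows "band_preserving ((*) \<phi>)"
proof (rule band_preserving_if_abs_le)
  show "linear ((*) \<phi>)"
    by (rule bounded_linear.linear[OF bounded_linear_mult_right])
  have "\<bar>\<phi> x * f x\<bar> \<le> norm \<phi> * \<bar>f x\<bar>" for f :: "'a \<Rightarrow>\<^sub>C real" and x
    using norm_bounded[of \<phi> x] by (simp add: abs_mult mult_right_mono)
  then show "\<bar>\<phi> * f\<bar> \<le> norm \<phi> *\<^sub>R \<bar>f\<bar>" for f
    by (simp add: less_eq_bcontfun.rep_eq)
qed

lemma positive_operator_bcontfun_mult:
  fixes \<phi> :: "'a :: topological_space \<Rightarrow>\<^sub>C real"
  assumes "0 \<le> \<phi>"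
  shows "positive_operator ((*) \<phi>)"
  using assms by (simp add: positive_operator_def less_eq_bcontfun.rep_eq)

lemma eps_band_preserving_abs_apply_le:
  fixes T :: "('k :: topological_space \<Rightarrow>\<^sub>C real) \<Rightarrow> ('k \<Rightarrow>\<^sub>C real)"
    and y :: "'k \<Rightarrow>\<^sub>C real"
  assumes "eps_band_preserving \<epsilon> T" and "0 \<le> y" and "lattice_disjoint y f" and "0 < y t"
  shows "\<bar>T f t\<bar> \<le> \<epsilon> * norm f"
proof -
  define z where "z = (norm (T f) / y t) *\<^sub>R y"
  have "0 \<le> z"
    unfolding z_def using assms by (intro scaleR_nonneg_nonneg) simp_all
  moreover have "lattice_disjoint z f"
    using assms by (auto simp: z_def lattice_disjoint_bcontfun_iff)
  ultimately have "norm (inf \<bar>T f\<bar> z) \<le> \<epsilon> * norm f"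
    by (rule eps_band_preservingD[OF assms(1)])
  moreover have "(inf \<bar>T f\<bar> z) t = \<bar>T f t\<bar>"
    using norm_bounded[of "T f" t] \<open>0 < y t\<close> by (simp add: z_def inf_absorb1)
  ultimately show ?thesis
    using norm_bounded[of "inf \<bar>T f\<bar> z" t] by simp
qed

lemma eps_band_preserving_abs_apply_diff_truncation_le:
  fixes T :: "('k :: topological_space \<Rightarrow>\<^sub>C real) \<Rightarrow> ('k \<Rightarrow>\<^sub>C real)"
    and e f :: "'k \<Rightarrow>\<^sub>C real"
  assumes "\<epsilon> \<ge> 0" and "eps_band_preserving \<epsilon> T" and "0 \<le> e" and "\<bar>f t\<bar> < e t"
  shows "\<bar>T (f - truncation e f) t\<bar> \<le> \<epsilon> * norm f"
proof -
  have "0 < pprt (e - \<bar>f\<bar>) t"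
    using assms(4) by (simp add: pprt_def sup_max)
  then have "\<bar>T (f - truncation e f) t\<bar> \<le> \<epsilon> * norm (f - truncation e f)"
    by (rule eps_band_preserving_abs_apply_le[OF assms(2) zero_le_pprt
          lattice_disjoint_diff_truncation])
  also have "\<dots> \<le> \<epsilon> * norm f"
    using assms(1,3) by (intro mult_left_mono norm_diff_truncation_le)
  finally show ?thesis .
qed

lemma eps_band_preserving_abs_apply_le_if_zero:
  fixes T :: "('k :: topological_space \<Rightarrow>\<^sub>C real) \<Rightarrow>\<^sub>L ('k \<Rightarrow>\<^sub>C real)"
    and f :: "'k \<Rightarrow>\<^sub>C real"
  assumes "\<epsilon> \<ge> 0" and T: "eps_band_preserving \<epsilon> (blinfun_apply T)" and "f t = 0"
  shows "\<bar>T f t\<bar> \<le> \<epsilon> * norm f"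
proof -
  have approx: "\<bar>T f t\<bar> \<le> \<epsilon> * norm f + norm T * \<delta>" if "\<delta> > 0" for \<delta>
  proof -
    define e :: "'k \<Rightarrow>\<^sub>C real" where "e = \<delta> *\<^sub>R 1"
    have e: "0 \<le> e" "norm e = \<delta>" "e t = \<delta>"
      using \<open>\<delta> > 0\<close> by (simp_all add: e_def less_eq_bcontfun.rep_eq)
    have "\<bar>T (f - truncation e f) t\<bar> \<le> \<epsilon> * norm f"
      using assms e \<open>\<delta> > 0\<close> by (intro eps_band_preserving_abs_apply_diff_truncation_le) simp_all
    moreover have "\<bar>T (truncation e f) t\<bar> \<le> norm T * \<delta>"
    proof -
      have "\<bar>T (truncation e f) t\<bar> \<le> norm (T (truncation e f))"
        using norm_bounded[of "T (truncation e f)" t] by simp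
      also have "\<dots> \<le> norm T * norm (truncation e f)"
        by (rule norm_blinfun)
      also have "\<dots> \<le> norm T * \<delta>"
        using norm_truncation_le[of e f] e by (simp add: mult_left_mono)
      finally show ?thesis .
    qed
    moreover have "T f t = T (f - truncation e f) t + T (truncation e f) t"
      by (simp add: blinfun.diff_right)
    ultimately show ?thesis
      by linarith
  qed
  have "((\<lambda>\<delta>. \<epsilon> * norm f + norm T * \<delta>) \<longlongrightarrow> \<epsilon> * norm f + norm T * 0) (at_right 0)"
    by (intro tendsto_intros)
  then have "\<bar>T f t\<bar> \<le> \<epsilon> * norm f + norm T * 0"
    by (rule tendsto_lowerbound) (auto simp: eventually_at_filter intro!: always_eventually approx)
  then show ?thesis
    by simp
qed

lemma norm_diff_mult_apply_one_le:
  fixes T :: "('k :: topological_space \<Rightarrow>\<^sub>C real) \<Rightarrow>\<^sub>L ('k \<Rightarrow>\<^sub>C real)"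
  assumes "\<epsilon> \<ge> 0" and "eps_band_preserving \<epsilon> (blinfun_apply T)"
  shows "norm (T - blinfun_mult_right (T 1)) \<le> 2 * \<epsilon>"
proof (rule norm_blinfun_bound)
  fix f :: "'k \<Rightarrow>\<^sub>C real"
  show "norm ((T - blinfun_mult_right (T 1)) f) \<le> 2 * \<epsilon> * norm f"
  proof (rule norm_bound)
    fix t
    define g where "g = f - f t *\<^sub>R 1"
    have "norm g \<le> norm f + norm (f t *\<^sub>R (1 :: 'k \<Rightarrow>\<^sub>C real))"
      unfolding g_def by (rule norm_triangle_ineq4)
    then have "norm g \<le> 2 * norm f"
      using norm_bounded[of f t] by simp
    then have "\<epsilon> * norm g \<le> \<epsilon> * (2 * norm f)"
      using \<open>\<epsilon> \<ge> 0\<close> by (rule mult_left_mono)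
    moreover have "\<bar>T g t\<bar> \<le> \<epsilon> * norm g"
      by (rule eps_band_preserving_abs_apply_le_if_zero[OF assms]) (simp add: g_def)
    moreover have "(T - blinfun_mult_right (T 1)) f t = T g t"
      by (simp add: g_def blinfun.diff_left blinfun.diff_right blinfun.scaleR_right)
    ultimately show "norm ((T - blinfun_mult_right (T 1)) f t) \<le> 2 * \<epsilon> * norm f"
      by simp
  qed
qed (use assms in simp)

theorem theorem6p2:
  fixes T :: "('k :: t2_space \<Rightarrow>\<^sub>C real) \<Rightarrow>\<^sub>L ('k \<Rightarrow>\<^sub>C real)"
    and \<epsilon> :: real
  assumes "compact (UNIV :: 'k set)"
    and "\<epsilon> \<ge> 0"
    and "eps_band_preserving \<epsilon> (blinfun_apply T)"
  shows "(\<exists>S :: ('k \<Rightarrow>\<^sub>C real) \<Rightarrow>\<^sub>L ('k \<Rightarrow>\<^sub>C real).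
            band_preserving (blinfun_apply S) \<and> norm (T - S) \<le> 2 * \<epsilon>) \<and>
         (positive_operator (blinfun_apply T) \<longrightarrow>
            (\<exists>S :: ('k \<Rightarrow>\<^sub>C real) \<Rightarrow>\<^sub>L ('k \<Rightarrow>\<^sub>C real).
               band_preserving (blinfun_apply S) \<and> positive_operator (blinfun_apply S) \<and>
               norm (T - S) \<le> 2 * \<epsilon>))"
proof -
  let ?S = "blinfun_mult_right (T 1)"
  have "band_preserving (blinfun_apply ?S)"
    by (simp add: band_preserving_bcontfun_mult)
  moreover have "positive_operator (blinfun_apply ?S)" if "positive_operator (blinfun_apply T)"
  proof -
    have "0 \<le> T 1"
      using that by (simp add: positive_operator_def less_eq_bcontfun.rep_eq)
    then show ?thesis
      by (simp add: positive_operator_bcontfun_mult)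
  qed
  moreover have "norm (T - ?S) \<le> 2 * \<epsilon>"
    using assms(2,3) by (rule norm_diff_mult_apply_one_le)
  ultimately show ?thesis
    by blast
qed

end
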